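(* For any triangle-free graph $G$ without induced matchings of size 2, $\beta(G)\leq \frac1{50}$.
   Context: All graphs are finite and simple. For a graph $G$ with $n\geq 1$ vertices, a half in $G$ is a function $\mu: V(G)\to[0,1]$ such that $\sum_{v\in V(G)}\mu(v)=n/2$. Put $\beta(G,\mu)=\frac1{n^2}\sum_{\{u,v\}\in E(G)}\mu(u)\mu(v)$ (each edge is counted once) and $\beta(G)=\min\{\beta(G,\mu): \mu \text{ is a half in } G\}$. An induced matching of size 2 in $G$ is a set of four distinct vertices whose induced subgraph consists of exactly two disjoint edges. *)

theory Defs
  imports
    "HOL-Analysis.Analysis"
    "Graph_Theory.Digraph_Component"
    "Graph_Theory.Pair_Digraph"
begin

text \<open>
  A finite simple graph is a \<open>pair_graph\<close>: a finite, symmetric, loop-free relation \<open>parcs G\<close>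
  on the vertex set \<open>pverts G\<close>. It contains both orientations of each edge, so that sums over
  edges are taken over the two-element sets in \<open>uedges G\<close>.
\<close>

definition uedges :: "'a pair_pre_digraph \<Rightarrow> 'a set set" where
  "uedges G = {{u, v} | u v. (u, v) \<in> parcs G}"

definition triangle_free :: "'a pair_pre_digraph \<Rightarrow> bool" where
  "triangle_free G \<longleftrightarrow>
    \<not> (\<exists>u v w. (u, v) \<in> parcs G \<and> (v, w) \<in> parcs G \<and> (u, w) \<in> parcs G)"

definition induced_2_matching :: "'a pair_pre_digraph \<Rightarrow> 'a set \<Rightarrow> bool" where
  "induced_2_matching G S \<longleftrightarrow> S \<subseteq> pverts G \<and>
    (\<exists>a b c d. distinct [a, b, c, d] \<and> S = {a, b, c, d} \<and>
      arcs (with_proj G \<restriction> S) = {(a, b), (b, a), (c, d), (d, c)})"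

text \<open>The values of \<open>\<mu>\<close> outside \<open>pverts G\<close> are irrelevant, here and in \<open>half_density\<close>.\<close>

definition is_half :: "'a pair_pre_digraph \<Rightarrow> ('a \<Rightarrow> real) \<Rightarrow> bool" where
  "is_half G \<mu> \<longleftrightarrow>
    \<mu> \<in> pverts G \<rightarrow> {0..1} \<and> (\<Sum>v\<in>pverts G. \<mu> v) = real (card (pverts G)) / 2"

text \<open>For a loop-free graph every \<open>e\<close> below has two elements, so the product is \<open>\<mu> u * \<mu> v\<close>.\<close>

definition half_density :: "'a pair_pre_digraph \<Rightarrow> ('a \<Rightarrow> real) \<Rightarrow> real" where
  "half_density G \<mu> = 1 / (real (card (pverts G)))\<^sup>2 * (\<Sum>e\<in>uedges G. \<Prod>v\<in>e. \<mu> v)"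

text \<open>The minimum over all halves; lemma \<open>beta_attained\<close> shows that it exists.\<close>

definition beta :: "'a pair_pre_digraph \<Rightarrow> real" where
  "beta G = (LEAST b. \<exists>\<mu>. is_half G \<mu> \<and> b = half_density G \<mu>)"

lemma half_density_cong:
  assumes "pair_graph G" "\<And>v. v \<in> pverts G \<Longrightarrow> \<mu> v = \<nu> v"
  shows "half_density G \<mu> = half_density G \<nu>"
proof -
  interpret pair_graph G by fact
  have "(\<Prod>v\<in>e. \<mu> v) = (\<Prod>v\<in>e. \<nu> v)" if "e \<in> uedges G" for e
    using that by (intro prod.cong refl assms(2)) (auto simp: uedges_def dest: wellformed')
  then show ?thesis by (simp add: half_density_def)
qed

lemma beta_attained:
  assumes "pair_graph G" "pverts G \<noteq> {}"
  obtains \<mu> where "is_half G \<mu>" "beta G = half_density G \<mu>"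
    "\<And>\<nu>. is_half G \<nu> \<Longrightarrow> beta G \<le> half_density G \<nu>"
proof -
  interpret pair_graph G by fact
  let ?V = "pverts G"
  define B where "B = (\<lambda>v. if v \<in> ?V then {0..1::real} else {0})"
  define K where "K = PiE UNIV B \<inter> {\<mu>. (\<Sum>v\<in>?V. \<mu> v) = real (card ?V) / 2}"
  have "compactin (product_topology (\<lambda>_. euclidean) UNIV) (PiE UNIV B)"
    by (subst compactin_PiE) (auto simp: B_def)
  then have "compact (PiE UNIV B)"
    by (simp add: euclidean_product_topology)
  moreover have "closed {\<mu>. (\<Sum>v\<in>?V. \<mu> v) = real (card ?V) / 2}"
    by (intro closed_Collect_eq continuous_intros continuous_on_product_coordinates)
  ultimately have "compact K"
    unfolding K_def by (rule compact_Int_closed)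
  have "(\<lambda>v. if v \<in> ?V then 1/2 else 0) \<in> K"
    by (auto simp: K_def B_def)
  then have "K \<noteq> {}" by blast
  have "continuous_on K (half_density G)"
    unfolding half_density_def[abs_def]
    by (intro continuous_intros continuous_on_subset[OF continuous_on_product_coordinates]) auto
  from continuous_attains_inf[OF \<open>compact K\<close> \<open>K \<noteq> {}\<close> this]
  obtain \<mu> where \<mu>: "\<mu> \<in> K" "\<And>\<nu>. \<nu> \<in> K \<Longrightarrow> half_density G \<mu> \<le> half_density G \<nu>"
    by blast
  have h: "is_half G \<mu>"
    using \<mu>(1) by (force simp: K_def B_def is_half_def PiE_iff split: if_splits)
  have le: "half_density G \<mu> \<le> half_density G \<nu>" if "is_half G \<nu>" for \<nu>
  proof -
    let ?\<nu> = "\<lambda>v. if v \<in> ?V then \<nu> v else 0"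
    have "?\<nu> \<in> K"
      using that by (auto simp: K_def B_def is_half_def)
    then have "half_density G \<mu> \<le> half_density G ?\<nu>" by (rule \<mu>(2))
    also have "\<dots> = half_density G \<nu>"
      by (rule half_density_cong[OF assms(1)]) simp
    finally show ?thesis .
  qed
  have "beta G = half_density G \<mu>"
    unfolding beta_def using h le by (intro Least_equality) auto
  with h le that show thesis by metis
qed

end

theory Submission
  imports Defs
begin

text \<open>
  A triangle-free graph \<open>G\<close> without induced matchings of size 2 has a homomorphism to the
  5-cycle: a pentagon in \<open>G\<close> dominates all non-isolated vertices and every such vertex imitates
  one of the five, while without a pentagon \<open>G\<close> is bipartite. Let \<open>b\<^sub>k\<close> be the sizes of the fibres.
  If \<open>b\<^sub>k + b\<^bsub>k+2\<^esub> \<ge> n/2\<close> for some \<open>k\<close>, there is a half supported on an independent set. Otherwise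
  averaging gives a \<open>j\<close> with \<open>b\<^bsub>j-2\<^esub> + b\<^sub>j + b\<^bsub>j+2\<^esub> \<ge> 3n/5\<close>. For \<open>s = 1, -1\<close>, a half that is \<open>1\<close> on
  the non-adjacent fibres \<open>j\<close>, \<open>j - 2s\<close> and puts the rest of the weight on the fibre \<open>j + s\<close> costs
  at most \<open>b\<^sub>j (n/2 - b\<^sub>j - b\<^bsub>j-2s\<^esub>)\<close>. The two costs add up to at most
  \<open>b\<^sub>j (2n/5 - b\<^sub>j) \<le> n\<^sup>2/25\<close>, so one of them is at most \<open>n\<^sup>2/50\<close>.
\<close>

section \<open>Homomorphisms to the 5-cycle\<close>

text \<open>The conclusion is a homomorphism to the 5-cycle: labels are read modulo 5, and the ends
  of an edge get cyclically consecutive labels. Likewise the pentagon \<open>c\<close> is indexed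
  periodically by integers. A non-isolated \<open>v\<close> gets a label \<open>i\<close> such that
  \<open>v\<close>, like \<open>c i\<close>, is adjacent to \<open>c (i - 1)\<close> and
  \<open>c (i + 1)\<close>.\<close>

lemma pentagon_hom:
  fixes E :: "'a rel" and c :: "int \<Rightarrow> 'a"
  assumes "sym E"
    and tri: "\<And>u v w. (u, v) \<in> E \<Longrightarrow> (v, w) \<in> E \<Longrightarrow> (u, w) \<notin> E"
    and two: "\<And>a b c d. (a, b) \<in> E \<Longrightarrow> (c, d) \<in> E \<Longrightarrow>
      (a, c) \<in> E \<or> (a, d) \<in> E \<or> (b, c) \<in> E \<or> (b, d) \<in> E"
    and per: "\<And>i j. i mod 5 = j mod 5 \<Longrightarrow> c i = c j"
    and cyc: "\<And>i. (c i, c (i + 1)) \<in> E"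
  shows "\<exists>f :: 'a \<Rightarrow> int. \<forall>(u, v)\<in>E. (f u - f v) mod 5 \<in> {1, 4}"
proof -
  have sy: "(x, y) \<in> E \<Longrightarrow> (y, x) \<in> E" for x y
    using \<open>sym E\<close> by (rule symD)
  have shift: "c (k + 5) = c k" for k
    by (rule per) simp
  have dominated: "\<exists>k. (v, c k) \<in> E" if "(v, w) \<in> E" for v w
  proof (rule ccontr)
    assume non: "\<nexists>k. (v, c k) \<in> E"
    \<comment> \<open>Only \<open>w\<close> can link the edge \<open>vw\<close> to a pentagon edge,
      and it sees just one end of it, since there are no triangles. So adjacency to \<open>w\<close>
      alternates around a cycle of odd length.\<close>
    have alt: "(w, c (k + 1)) \<in> E \<longleftrightarrow> (w, c k) \<notin> E" for k
      using two[OF that cyc[of k]] non tri[OF _ cyc[of k], of w] by blast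
    have "(w, c 5) \<in> E \<longleftrightarrow> (w, c 0) \<notin> E"
      using alt[of 0] alt[of 1] alt[of 2] alt[of 3] alt[of 4] by simp
    with shift[of 0] show False by simp
  qed
  have "\<exists>i. (v, c (i - 1)) \<in> E \<and> (v, c (i + 1)) \<in> E" if "(v, w) \<in> E" for v w
  proof -
    obtain k where k: "(v, c k) \<in> E"
      using dominated[OF \<open>(v, w) \<in> E\<close>] by blast
    have "(c k, c (k + 2)) \<notin> E"
      using tri[OF cyc[of k] cyc[of "k + 1"]] by (simp add: add.assoc)
    moreover have "(c k, c (k + 3)) \<notin> E"
      using tri[OF cyc[of "k + 3"], of "c k"] cyc[of "k + 4"] shift[of k] sy by (auto simp: add.assoc)
    \<comment> \<open>The edge from \<open>v\<close> to \<open>c k\<close> is compared with the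
      opposite edge of the pentagon, which has no neighbour of \<open>c k\<close>.\<close>
    ultimately have "(v, c (k + 2)) \<in> E \<or> (v, c (k + 3)) \<in> E"
      using two[OF k cyc[of "k + 2"]] by (auto simp: add.assoc)
    moreover have "c (k + 3) = c (k - 2)"
      using shift[of "k - 2"] by (simp add: algebra_simps)
    ultimately have "(v, c (k + 1 - 1)) \<in> E \<and> (v, c (k + 1 + 1)) \<in> E \<or>
        (v, c (k - 1 - 1)) \<in> E \<and> (v, c (k - 1 + 1)) \<in> E"
      using k by (simp add: algebra_simps)
    then show ?thesis by blast
  qed
  then have "\<forall>v. \<exists>i. (\<exists>w. (v, w) \<in> E) \<longrightarrow> (v, c (i - 1)) \<in> E \<and> (v, c (i + 1)) \<in> E"
    by blast
  then obtain f where f: "\<And>v w. (v, w) \<in> E \<Longrightarrow> (v, c (f v - 1)) \<in> E \<and> (v, c (f v + 1)) \<in> E"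
    by metis
  have "(f u - f v) mod 5 \<in> {1, 4}" if uv: "(u, v) \<in> E" for u v
  proof (rule ccontr)
    assume "(f u - f v) mod 5 \<notin> {1, 4}"
    \<comment> \<open>If the labels differ by 0, 2 or 3, then \<open>u\<close> and \<open>v\<close>
      have a common neighbour on the pentagon, which closes a triangle.\<close>
    then have "(f u - 1) mod 5 = (f v - 1) mod 5 \<or> (f u - 1) mod 5 = (f v + 1) mod 5 \<or>
        (f u + 1) mod 5 = (f v - 1) mod 5"
      by (simp add: mod_eq_dvd_iff) presburger
    then have "c (f u - 1) = c (f v - 1) \<or> c (f u - 1) = c (f v + 1) \<or> c (f u + 1) = c (f v - 1)"
      using per[of "f u - 1" "f v - 1"] per[of "f u - 1" "f v + 1"] per[of "f u + 1" "f v - 1"]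
      by blast
    then have "\<exists>i. (u, c i) \<in> E \<and> (v, c i) \<in> E"
      using f[OF uv] f[OF sy[OF uv]] by (elim disjE) metis+
    then show False
      using tri uv by blast
  qed
  then show ?thesis by blast
qed

lemma pentagon_free_hom:
  fixes E :: "'a rel"
  assumes "sym E"
    and tri: "\<And>u v w. (u, v) \<in> E \<Longrightarrow> (v, w) \<in> E \<Longrightarrow> (u, w) \<notin> E"
    and two: "\<And>a b c d. (a, b) \<in> E \<Longrightarrow> (c, d) \<in> E \<Longrightarrow>
      (a, c) \<in> E \<or> (a, d) \<in> E \<or> (b, c) \<in> E \<or> (b, d) \<in> E"
    and pent: "\<And>a b c d e. \<lbrakk>(a, b) \<in> E; (b, c) \<in> E; (c, d) \<in> E; (d, e) \<in> E; (e, a) \<in> E\<rbrakk> \<Longrightarrow> False"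
  shows "\<exists>f :: 'a \<Rightarrow> int. \<forall>(u, v)\<in>E. (f u - f v) mod 5 \<in> {1, 4}"
proof (cases "E = {}")
  case False
  then obtain a b where ab: "(a, b) \<in> E" by auto
  have sy: "(x, y) \<in> E \<Longrightarrow> (y, x) \<in> E" for x y
    using \<open>sym E\<close> by (rule symD)
  \<comment> \<open>Every edge meets a neighbour of \<open>a\<close> or \<open>b\<close>, and a vertex adjacent to neither \<open>a\<close> nor \<open>b\<close>
    cannot have neighbours on both sides, as this would close a pentagon through \<open>ab\<close>.\<close>
  define S where "S = {v. (v, b) \<in> E \<or> (v, a) \<notin> E \<and> (\<exists>w. (v, w) \<in> E \<and> (w, a) \<in> E)}"
  have "(u \<in> S) \<noteq> (v \<in> S)" if uv: "(u, v) \<in> E" for u v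
  proof -
    have "(u, a) \<in> E \<or> (u, b) \<in> E \<or> (v, a) \<in> E \<or> (v, b) \<in> E"
      using two[OF uv ab] by blast
    moreover have "(u, a) \<notin> E \<or> (u, b) \<notin> E" "(v, a) \<notin> E \<or> (v, b) \<notin> E"
      using tri ab sy by meson+
    moreover have "(u, a) \<notin> E \<or> (v, a) \<notin> E" "(u, b) \<notin> E \<or> (v, b) \<notin> E"
      using tri uv by meson+
    moreover have "\<not> ((x, y) \<in> E \<and> (y, a) \<in> E \<and> (x, z) \<in> E \<and> (z, b) \<in> E)" for x y z
      using pent[of x y a b z] ab sy by blast
    ultimately show ?thesis
      using uv sy unfolding S_def by blast
  qed
  then show ?thesis
    by (intro exI[of _ "\<lambda>v. if v \<in> S then 1 else 0"]) auto
qed simp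

text \<open>The case split is on closed walks of length 5. Without triangles and loops these are
  genuine pentagons, as a repeated vertex would leave a shorter odd cycle.\<close>

lemma ex_hom_C5:
  fixes E :: "'a rel"
  assumes "sym E"
    and tri: "\<And>u v w. (u, v) \<in> E \<Longrightarrow> (v, w) \<in> E \<Longrightarrow> (u, w) \<notin> E"
    and two: "\<And>a b c d. (a, b) \<in> E \<Longrightarrow> (c, d) \<in> E \<Longrightarrow>
      (a, c) \<in> E \<or> (a, d) \<in> E \<or> (b, c) \<in> E \<or> (b, d) \<in> E"
  shows "\<exists>f :: 'a \<Rightarrow> int. \<forall>(u, v)\<in>E. (f u - f v) mod 5 \<in> {1, 4}"
proof (cases "\<exists>a b c d e. (a, b) \<in> E \<and> (b, c) \<in> E \<and> (c, d) \<in> E \<and> (d, e) \<in> E \<and> (e, a) \<in> E")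
  case True
  then obtain p0 p1 p2 p3 p4 where
    p: "(p0, p1) \<in> E" "(p1, p2) \<in> E" "(p2, p3) \<in> E" "(p3, p4) \<in> E" "(p4, p0) \<in> E"
    by blast
  define c :: "int \<Rightarrow> 'a" where
    "c i = (if i mod 5 = 0 then p0 else if i mod 5 = 1 then p1 else if i mod 5 = 2 then p2
      else if i mod 5 = 3 then p3 else p4)" for i
  have "(c i, c (i + 1)) \<in> E" for i
  proof -
    have "i mod 5 = 0 \<and> (i + 1) mod 5 = 1 \<or> i mod 5 = 1 \<and> (i + 1) mod 5 = 2 \<or>
        i mod 5 = 2 \<and> (i + 1) mod 5 = 3 \<or> i mod 5 = 3 \<and> (i + 1) mod 5 = 4 \<or>
        i mod 5 = 4 \<and> (i + 1) mod 5 = 0"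
      by presburger
    then show ?thesis
      by (elim disjE) (simp_all add: c_def p)
  qed
  moreover have "c i = c j" if "i mod 5 = j mod 5" for i j
    using that by (simp add: c_def)
  ultimately show ?thesis
    by (intro pentagon_hom[where c = c] assms)
next
  case False
  then show ?thesis
    by (intro pentagon_free_hom assms) blast+
qed

section \<open>Halves on a few fibres\<close>

text \<open>All edges of nonzero weight join \<open>Y\<close> to \<open>Z\<close>. Completing them
  to all pairs in \<open>Y \<times> Z\<close> only adds nonnegative terms, and the resulting sum
  factors.\<close>

lemma sum_uedges_le:
  fixes \<mu> :: "'a \<Rightarrow> real"
  assumes "pair_graph G" and sub: "Y \<subseteq> pverts G" "Z \<subseteq> pverts G" and dis: "Y \<inter> Z = {}"
    and nonneg: "\<And>v. v \<in> pverts G \<Longrightarrow> 0 \<le> \<mu> v"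
    and edge: "\<And>u v. (u, v) \<in> parcs G \<Longrightarrow>
      \<mu> u = 0 \<or> \<mu> v = 0 \<or> u \<in> Y \<and> v \<in> Z \<or> u \<in> Z \<and> v \<in> Y"
  shows "(\<Sum>e\<in>uedges G. \<Prod>v\<in>e. \<mu> v) \<le> sum \<mu> Y * sum \<mu> Z"
proof -
  interpret pair_graph G by fact
  let ?g = "\<lambda>(y, z). {y, z}"
  have fin: "finite Y" "finite Z"
    using sub by (auto intro: finite_subset)
  have "uedges G = (\<lambda>(u, v). {u, v}) ` parcs G"
    by (auto simp: uedges_def)
  then have finU: "finite (uedges G)" by simp
  have inj: "inj_on ?g (Y \<times> Z)"
    using dis by (auto simp: inj_on_def doubleton_eq_iff)
  have prod2: "(\<Prod>v\<in>{y, z}. \<mu> v) = \<mu> y * \<mu> z" if "y \<noteq> z" for y z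
    using that by simp
  have "(\<Sum>e\<in>uedges G. \<Prod>v\<in>e. \<mu> v) \<le> (\<Sum>e\<in>?g ` (Y \<times> Z). \<Prod>v\<in>e. \<mu> v)"
  proof -
    have "(\<Prod>v\<in>e. \<mu> v) = 0" if eU: "e \<in> uedges G" and eYZ: "e \<notin> ?g ` (Y \<times> Z)" for e
    proof -
      obtain u v where e: "e = {u, v}" "(u, v) \<in> parcs G"
        using eU unfolding uedges_def by blast
      then have "\<mu> u = 0 \<or> \<mu> v = 0"
        using edge[OF e(2)] eYZ by (auto simp: image_iff insert_commute)
      then show ?thesis
        by (auto simp: e(1))
    qed
    then have "(\<Sum>e\<in>uedges G. \<Prod>v\<in>e. \<mu> v) = (\<Sum>e\<in>uedges G \<inter> ?g ` (Y \<times> Z). \<Prod>v\<in>e. \<mu> v)"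
      using finU by (intro sum.mono_neutral_right) auto
    also have "\<dots> \<le> (\<Sum>e\<in>?g ` (Y \<times> Z). \<Prod>v\<in>e. \<mu> v)"
      using sub fin by (intro sum_mono2) (auto intro!: prod_nonneg nonneg)
    finally show ?thesis .
  qed
  also have "\<dots> = (\<Sum>(y, z)\<in>Y \<times> Z. \<mu> y * \<mu> z)"
    unfolding sum.reindex[OF inj] using dis by (intro sum.cong) (auto intro!: prod2)
  also have "\<dots> = sum \<mu> Y * sum \<mu> Z"
    by (simp add: sum_product sum.cartesian_product)
  finally show ?thesis .
qed

lemma beta_le:
  fixes \<mu> :: "'a \<Rightarrow> real"
  assumes G: "pair_graph G" "pverts G \<noteq> {}"
    and half: "is_half G \<mu>"
    and YZ: "Y \<subseteq> pverts G" "Z \<subseteq> pverts G" "Y \<inter> Z = {}"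
    and edge: "\<And>u v. (u, v) \<in> parcs G \<Longrightarrow>
      \<mu> u = 0 \<or> \<mu> v = 0 \<or> u \<in> Y \<and> v \<in> Z \<or> u \<in> Z \<and> v \<in> Y"
  shows "beta G \<le> sum \<mu> Y * sum \<mu> Z / (real (card (pverts G)))\<^sup>2"
proof -
  have "beta G \<le> half_density G \<mu>"
    using beta_attained[OF G] half by metis
  also have "\<dots> \<le> sum \<mu> Y * sum \<mu> Z / (real (card (pverts G)))\<^sup>2"
    using sum_uedges_le[OF G(1) YZ _ edge] half
    by (auto simp: half_density_def is_half_def Pi_iff intro!: divide_right_mono)
  finally show ?thesis .
qed

text \<open>Weight \<open>n/2\<close> spread evenly over \<open>I\<close> gives each vertex at most
  1, and every edge has an end of weight 0.\<close>

lemma beta_le_0: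
  assumes G: "pair_graph G" "pverts G \<noteq> {}"
    and I: "I \<subseteq> pverts G" "real (card (pverts G)) / 2 \<le> real (card I)"
    and indep: "\<And>u v. (u, v) \<in> parcs G \<Longrightarrow> u \<notin> I \<or> v \<notin> I"
  shows "beta G \<le> 0"
proof -
  interpret pair_graph G by fact
  let ?n = "real (card (pverts G))"
  define \<mu> where "\<mu> v = (if v \<in> I then ?n / (2 * real (card I)) else 0)" for v
  have n: "?n > 0"
    using G(2) by (simp add: card_gt_0_iff)
  then have "card I > 0"
    using I(2) by linarith
  then have "\<mu> v \<in> {0..1}" for v
    using I(2) by (auto simp: \<mu>_def divide_simps)
  moreover have "sum \<mu> (pverts G) = ?n / 2"
    using I(1) \<open>card I > 0\<close> by (simp add: \<mu>_def sum.If_cases Int_absorb1)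
  ultimately have "is_half G \<mu>"
    by (simp add: is_half_def)
  from beta_le[OF G this, of "{}" "{}"] show ?thesis
    using indep by (force simp: \<mu>_def)
qed

text \<open>The half is 1 on \<open>X\<close> and \<open>Y\<close> and constant on \<open>Z\<close>;
  \<open>lo\<close> and \<open>hi\<close> put this constant between 0 and 1. Only edges between
  \<open>Y\<close> and \<open>Z\<close> cost anything.\<close>

lemma beta_le_three_sets:
  assumes G: "pair_graph G" "pverts G \<noteq> {}"
    and sub: "X \<subseteq> pverts G" "Y \<subseteq> pverts G" "Z \<subseteq> pverts G"
    and dis: "X \<inter> Y = {}" "X \<inter> Z = {}" "Y \<inter> Z = {}"
    and lo: "real (card X) + real (card Y) \<le> real (card (pverts G)) / 2"
    and hi: "real (card (pverts G)) / 2 \<le> real (card X) + real (card Y) + real (card Z)"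
    and edge: "\<And>u v. \<lbrakk>(u, v) \<in> parcs G; u \<in> X \<union> Y \<union> Z; v \<in> X \<union> Y \<union> Z\<rbrakk> \<Longrightarrow>
      u \<in> Y \<and> v \<in> Z \<or> u \<in> Z \<and> v \<in> Y"
  shows "beta G \<le> real (card Y) * (real (card (pverts G)) / 2 - real (card X) - real (card Y))
    / (real (card (pverts G)))\<^sup>2"
proof -
  interpret pair_graph G by fact
  let ?n = "real (card (pverts G))"
  define t where "t = (?n / 2 - real (card X) - real (card Y)) / real (card Z)"
    \<comment> \<open>if \<open>Z\<close> is empty, the numerator is \<open>0\<close> as well\<close>
  define \<mu> where "\<mu> v = (if v \<in> X \<union> Y then 1 else if v \<in> Z then t else 0)" for v
  have fin: "finite X" "finite Y" "finite Z"
    using sub by (auto intro: finite_subset)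
  have t: "0 \<le> t" "t \<le> 1"
    using lo hi by (auto simp: t_def divide_simps)
  have sums: "sum \<mu> X = card X" "sum \<mu> Y = card Y"
    by (simp_all add: \<mu>_def)
  have "sum \<mu> Z = (\<Sum>v\<in>Z. t)"
    using dis by (intro sum.cong) (auto simp: \<mu>_def)
  also have "\<dots> = ?n / 2 - real (card X) - real (card Y)"
    using lo hi by (auto simp: t_def)
  finally have Z: "sum \<mu> Z = ?n / 2 - real (card X) - real (card Y)" .
  have "sum \<mu> (pverts G) = sum \<mu> (X \<union> Y \<union> Z)"
    using sub by (intro sum.mono_neutral_right) (auto simp: \<mu>_def)
  also have "\<dots> = sum \<mu> X + sum \<mu> Y + sum \<mu> Z"
    using dis fin by (simp add: sum.union_disjoint Int_Un_distrib2)
  finally have "is_half G \<mu>"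
    using t sums Z by (auto simp: is_half_def \<mu>_def)
  moreover have "\<mu> u = 0 \<or> \<mu> v = 0 \<or> u \<in> Y \<and> v \<in> Z \<or> u \<in> Z \<and> v \<in> Y"
    if "(u, v) \<in> parcs G" for u v
    using edge[OF that] by (cases "u \<in> X \<union> Y \<union> Z \<and> v \<in> X \<union> Y \<union> Z") (auto simp: \<mu>_def)
  ultimately have "beta G \<le> sum \<mu> Y * sum \<mu> Z / ?n\<^sup>2"
    by (intro beta_le G sub dis) auto
  then show ?thesis
    unfolding sums Z .
qed

section \<open>Graphs with a homomorphism to the 5-cycle\<close>

lemma beta_le_if_hom_C5:
  fixes f :: "'a \<Rightarrow> int"
  assumes G: "pair_graph G" "pverts G \<noteq> {}"
    and hom: "\<And>u v. (u, v) \<in> parcs G \<Longrightarrow> (f u - f v) mod 5 \<in> {1, 4}"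
  shows "beta G \<le> 1 / 50"
proof -
  interpret pair_graph G by fact
  define n where "n = real (card (pverts G))"
  define F where "F k = {v \<in> pverts G. f v mod 5 = k mod 5}" for k
  define b where "b k = real (card (F k))" for k
  have n: "n > 0"
    using G(2) by (simp add: n_def card_gt_0_iff)
  have sub: "F k \<subseteq> pverts G" and fin: "finite (F k)" for k
    by (auto simp: F_def)
  have per: "b i = b j" if "i mod 5 = j mod 5" for i j
    using that by (simp add: b_def F_def)
  have disj: "F i \<inter> F j = {}" if "(i - j) mod 5 \<noteq> 0" for i j
  proof -
    have "i mod 5 \<noteq> j mod 5"
      using that by (simp add: mod_eq_dvd_iff dvd_eq_mod_eq_0)
    then show ?thesis
      by (auto simp: F_def)
  qed
  have linked: "(i - j) mod 5 \<in> {1, 4}" if "(u, v) \<in> parcs G" "u \<in> F i" "v \<in> F j" for u v i j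
  proof -
    have "(f u - f v) mod 5 = (i - j) mod 5"
      using that(2,3) by (intro mod_diff_cong) (auto simp: F_def)
    with hom[OF that(1)] show ?thesis
      by (simp only:)
  qed
  have total: "b k + b (k + 1) + b (k + 2) + b (k + 3) + b (k + 4) = n" for k
  proof -
    have "pverts G = (\<Union>i\<in>{k..k+4}. F i)"
    proof -
      have "\<exists>i\<in>{k..k+4}. x mod 5 = i mod 5" for x
      proof
        show "x mod 5 = (k + (x - k) mod 5) mod 5"
          by (simp add: mod_simps)
        show "k + (x - k) mod 5 \<in> {k..k+4}"
          using pos_mod_bound[of 5 "x - k"] by simp
      qed
      then show ?thesis
        by (auto simp: F_def)
    qed
    moreover have "card (\<Union>i\<in>{k..k+4}. F i) = (\<Sum>i\<in>{k..k+4}. card (F i))"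
    proof (intro card_UN_disjoint ballI impI)
      fix i j assume "i \<in> {k..k+4}" "j \<in> {k..k+4}" "i \<noteq> j"
      then have "(i - j) mod 5 \<noteq> 0"
        by (simp, presburger)
      then show "F i \<inter> F j = {}"
        by (rule disj)
    qed (use fin in auto)
    moreover have "{k..k+4} = {k, k+1, k+2, k+3, k+4}"
      by auto
    ultimately show ?thesis
      by (simp add: n_def b_def)
  qed
  show ?thesis
  proof (cases "\<exists>k. n / 2 \<le> b k + b (k + 2)")
    case True
    then obtain k where k: "n / 2 \<le> b k + b (k + 2)" by blast
    have "card (F k \<union> F (k + 2)) = card (F k) + card (F (k + 2))"
      using fin by (intro card_Un_disjoint disj) auto
    moreover have "u \<notin> F k \<union> F (k + 2) \<or> v \<notin> F k \<union> F (k + 2)" if "(u, v) \<in> parcs G" for u v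
      using linked[OF that] by fastforce
    ultimately have "beta G \<le> 0"
      using k sub by (intro beta_le_0[OF G, of "F k \<union> F (k + 2)"]) (auto simp: n_def b_def)
    then show ?thesis by simp
  next
    case False
    then have small: "b k + b (k + 2) < n / 2" for k
      by (meson not_le)
    have cost: "beta G \<le> b j * (n / 2 - b (j - 2 * s) - b j) / n\<^sup>2" if s: "s = 1 \<or> s = -1" for j s
    proof -
      have "b (j - 2 * s) + b j \<le> n / 2"
        using s small[of j] small[of "j - 2"] by auto
      \<comment> \<open>The two other fibres, \<open>j + 2 * s\<close> and \<open>j - s\<close>, are
        two apart on the cycle, so by \<open>small\<close> they have fewer than \<open>n / 2\<close>
        vertices together.\<close>
      moreover have "n / 2 \<le> b (j - 2 * s) + b j + b (j + s)"
        using s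
      proof
        assume "s = 1"
        moreover have "b (j + 3) = b (j - 2)" "b (j + 4) = b (j + 2 + 2)"
          by (rule per, presburger)+
        ultimately show ?thesis
          using total[of j] small[of "j + 2"] by simp
      next
        assume "s = -1"
        moreover have "b (j + 4) = b (j - 1)" "b (j + 1 + 2) = b (j + 3)"
          by (rule per, presburger)+
        ultimately show ?thesis
          using total[of j] small[of "j + 1"] by simp
      qed
      ultimately show ?thesis
        unfolding b_def n_def
      proof (intro beta_le_three_sets[OF G sub sub sub])
        show "F (j - 2 * s) \<inter> F j = {}" "F (j - 2 * s) \<inter> F (j + s) = {}" "F j \<inter> F (j + s) = {}"
          using s by (intro disj; auto)+
        fix u v
        assume uv: "(u, v) \<in> parcs G" "u \<in> F (j - 2 * s) \<union> F j \<union> F (j + s)"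
          "v \<in> F (j - 2 * s) \<union> F j \<union> F (j + s)"
        show "u \<in> F j \<and> v \<in> F (j + s) \<or> u \<in> F (j + s) \<and> v \<in> F j"
          using s uv(2,3) linked[OF uv(1)] by (elim disjE UnE; fastforce)
      qed
    qed
    \<comment> \<open>Over the five residues \<open>j\<close>, these sums count every fibre three
      times and so add up to \<open>3 * n\<close>.\<close>
    have "\<exists>j. b (j - 2) + b j + b (j + 2) \<ge> 3 * n / 5"
    proof (rule ccontr)
      assume "\<not> ?thesis"
      then have lt: "b (j - 2) + b j + b (j + 2) < 3 * n / 5" for j
        by (meson not_le)
      have "b (-2) = b 3" "b (-1) = b 4" "b 5 = b 0" "b 6 = b 1"
        by (rule per, simp)+
      then show False
        using lt[of 0] lt[of 1] lt[of 2] lt[of 3] lt[of 4] total[of 0] by simp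
    qed
    then obtain j where j: "b (j - 2) + b j + b (j + 2) \<ge> 3 * n / 5" by blast
    have "beta G * n\<^sup>2 \<le> b j * (n / 2 - b (j - 2) - b j)"
      "beta G * n\<^sup>2 \<le> b j * (n / 2 - b (j + 2) - b j)"
      using cost[of 1 j] cost[of "-1" j] n by (simp_all add: pos_le_divide_eq)
    then have "2 * (beta G * n\<^sup>2) \<le> b j * (n - b (j - 2) - b (j + 2) - 2 * b j)"
      by (simp add: algebra_simps)
    \<comment> \<open>By the choice of \<open>j\<close>, the fibres \<open>j - 2\<close> and
      \<open>j + 2\<close> have at least \<open>3 * n / 5 - b j\<close> vertices together. The
      resulting quadratic in \<open>b j\<close> is largest at \<open>n / 5\<close>.\<close>
    also have "\<dots> \<le> b j * (2 * n / 5 - b j)"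
      using j by (intro mult_left_mono) (auto simp: b_def)
    also have "\<dots> \<le> n\<^sup>2 / 25"
      using zero_le_power2[of "n / 5 - b j"] by (simp add: power2_eq_square algebra_simps)
    finally have "beta G * n\<^sup>2 \<le> 1 / 50 * n\<^sup>2" by simp
    then show ?thesis
      using n by (simp only: mult_le_cancel_right_pos zero_less_power)
  qed
qed

text \<open>Two edges without a link between them would span an induced matching. Edges that share a
  vertex are covered too: the shared vertex is joined to the other end of either edge.\<close>

lemma edges_linked_if_no_induced_2_matching:
  assumes "pair_graph G" and no: "\<nexists>S. induced_2_matching G S"
    and ab: "(a, b) \<in> parcs G" and cd: "(c, d) \<in> parcs G"
  shows "(a, c) \<in> parcs G \<or> (a, d) \<in> parcs G \<or> (b, c) \<in> parcs G \<or> (b, d) \<in> parcs G"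
proof (rule ccontr)
  interpret pair_graph G by fact
  assume non: "\<not> ?thesis"
  have sy: "(x, y) \<in> parcs G \<Longrightarrow> (y, x) \<in> parcs G" for x y
    by (rule arcs_symmetric)
  have irr: "(x, x) \<notin> parcs G" for x
    using no_loops' by blast
  have "distinct [a, b, c, d]"
    using non ab cd irr sy by auto
  moreover have "arcs (with_proj G \<restriction> {a, b, c, d}) = {(a, b), (b, a), (c, d), (d, c)}"
    using ab cd non irr by (auto intro: sy dest: sy)
  moreover have "{a, b, c, d} \<subseteq> pverts G"
    using ab cd wellformed' by auto
  ultimately have "induced_2_matching G {a, b, c, d}"
    unfolding induced_2_matching_def by blast
  then show False using no by blast
qed

theorem theorem3p3:
  fixes G :: "'a pair_pre_digraph"
  assumes "pair_graph G"
    and "pverts G \<noteq> {}"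
    and "triangle_free G"
    and "\<nexists>S. induced_2_matching G S"
  shows "beta G \<le> 1 / 50"
proof -
  interpret pair_graph G by fact
  have "\<exists>f :: 'a \<Rightarrow> int. \<forall>(u, v)\<in>parcs G. (f u - f v) mod 5 \<in> {1, 4}"
  proof (rule ex_hom_C5)
    show "sym (parcs G)"
      by (auto intro: symI arcs_symmetric)
    show "(u, w) \<notin> parcs G" if "(u, v) \<in> parcs G" "(v, w) \<in> parcs G" for u v w
      using that assms(3) by (auto simp: triangle_free_def)
  qed (rule edges_linked_if_no_induced_2_matching[OF assms(1,4)])
  then show ?thesis
    using beta_le_if_hom_C5[OF assms(1,2)] by blast
qed

end
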